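(* Let $X=\{P_1,\dots,P_r\}$ be a set of $r$ distinct points of $\mathbb P^n_{\mathbf k}\setminus\{x_n=0\}$, not contained in a hyperplane. Let $\{F_t\}_{t\ge1}$ be a family of elements of $I(X)^\perp$ such that $x_n\circ F_t=F_{t-1}$ for all $t>1$ and $x_n\circ F_1=0$. Then for all $t\ge1$ $$\langle F_1\rangle\subseteq\operatorname{Ann}_R(F_1)\circ F_2\subseteq\cdots\subseteq\operatorname{Ann}_R(F_t)\circ F_{t+1}\subseteq\operatorname{Ann}_R(F_{t+1})\circ F_{t+2}\subseteq(I(X)+(x_n))^\perp.$$
   Context: $\mathbf k$ is an algebraically closed field of characteristic zero, $n\ge1$, $R=\mathbf k[x_0,\dots,x_n]$ and $\Gamma=\mathbf k[y_0,\dots,y_n]$. $R$ acts on $\Gamma$ by differentiation: $f\circ g=f(\partial_{y_0},\dots,\partial_{y_n})(g)$, making $\Gamma$ an $R$-module. $\langle F_1\rangle$ is the $R$-submodule generated by $F_1$. For an ideal $I\subset R$, $I^\perp=\{G\in\Gamma: I\circ G=0\}$; for $G\in\Gamma$, $\operatorname{Ann}_R(G)=\{g\in R: g\circ G=0\}$; for an ideal $\mathfrak a$, $\mathfrak a\circ G=\{g\circ G: g\in\mathfrak a\}$. $I(X)\subset R$ is the homogeneous ideal of $X$. *)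

theory Defs
  imports
    "HOL-Library.Poly_Mapping"
    "HOL-Library.Set_Algebras"
    "HOL-Computational_Algebra.Polynomial"
begin

text \<open>
  Polynomials over \<open>'k\<close> in variables indexed by a finite type \<open>'v\<close>, as finitely supported
  functions from exponent vectors to coefficients.  The rings \<open>R = k[x\<^sub>0,\<dots>,x\<^sub>n]\<close> and
  \<open>\<Gamma> = k[y\<^sub>0,\<dots>,y\<^sub>n]\<close> are both rendered by this type.  In the theorem
  \<open>'v = 'n option\<close> with \<open>'n\<close> an arbitrary finite (hence nonempty) type and \<open>n = CARD('n) \<ge> 1\<close>:
  the indices \<open>Some i\<close> stand for \<open>0,\<dots>,n-1\<close> and \<open>None\<close> stands for \<open>n\<close>.
\<close>

type_synonym ('v, 'k) mpoly = "('v \<Rightarrow>\<^sub>0 nat) \<Rightarrow>\<^sub>0 'k"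

definition Var :: "'v \<Rightarrow> ('v, 'k::comm_ring_1) mpoly" where
  "Var i = Poly_Mapping.single (Poly_Mapping.single i 1) 1"

definition Const :: "'k \<Rightarrow> ('v, 'k::comm_ring_1) mpoly" where
  "Const c = Poly_Mapping.single 0 c"

definition eval_at :: "('v::finite \<Rightarrow> 'k) \<Rightarrow> ('v, 'k::comm_ring_1) mpoly \<Rightarrow> 'k" where
  "eval_at v f = (\<Sum>m\<in>Poly_Mapping.keys f. Poly_Mapping.lookup f m * (\<Prod>i\<in>UNIV. v i ^ Poly_Mapping.lookup m i))"

definition homogeneous :: "nat \<Rightarrow> ('v::finite, 'k::comm_ring_1) mpoly \<Rightarrow> bool" where
  "homogeneous d f \<longleftrightarrow> (\<forall>m\<in>Poly_Mapping.keys f. (\<Sum>i\<in>UNIV. Poly_Mapping.lookup m i) = d)"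


subsection \<open>The action by differentiation\<close>

text \<open>The subtraction of exponent vectors is truncated, but when it truncates the coefficient
  \<open>Poly_Mapping.lookup m i\<close> is zero.\<close>

definition partial :: "'v \<Rightarrow> ('v, 'k::comm_ring_1) mpoly \<Rightarrow> ('v, 'k) mpoly" where
  "partial i g =
     (\<Sum>m\<in>Poly_Mapping.keys g. Poly_Mapping.single (m - Poly_Mapping.single i 1) (of_nat (Poly_Mapping.lookup m i) * Poly_Mapping.lookup g m))"

text \<open>The operator \<open>\<Prod>\<^sub>i \<partial>\<^sub>i\<^bsup>m\<^sub>i\<^esup>\<close>; the order of composition is irrelevant because the
  partial derivatives commute (\<open>partial_commute\<close> below).\<close>

definition partials :: "('v::finite \<Rightarrow>\<^sub>0 nat) \<Rightarrow> ('v, 'k::comm_ring_1) mpoly \<Rightarrow> ('v, 'k) mpoly" where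
  "partials m g = Finite_Set.fold (\<lambda>i. partial i ^^ Poly_Mapping.lookup m i) g UNIV"

definition diff_act :: "('v::finite, 'k::comm_ring_1) mpoly \<Rightarrow> ('v, 'k) mpoly \<Rightarrow> ('v, 'k) mpoly"
    (infixr \<open>\<odot>\<close> 75) where
  "f \<odot> g = (\<Sum>m\<in>Poly_Mapping.keys f. Const (Poly_Mapping.lookup f m) * partials m g)"

definition Ann :: "('v::finite, 'k::comm_ring_1) mpoly \<Rightarrow> ('v, 'k) mpoly set" where
  "Ann G = {g. g \<odot> G = 0}"

definition perp :: "('v::finite, 'k::comm_ring_1) mpoly set \<Rightarrow> ('v, 'k) mpoly set" where
  "perp I = {G. \<forall>g\<in>I. g \<odot> G = 0}"

definition act_set :: "('v::finite, 'k::comm_ring_1) mpoly set \<Rightarrow> ('v, 'k) mpoly \<Rightarrow> ('v, 'k) mpoly set" where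
  "act_set A G = {g \<odot> G | g. g \<in> A}"

definition submodule_gen :: "('v::finite, 'k::comm_ring_1) mpoly set \<Rightarrow> ('v, 'k) mpoly set" where
  "submodule_gen S = module.span diff_act S"

definition ideal_gen :: "('v, 'k::comm_ring_1) mpoly set \<Rightarrow> ('v, 'k) mpoly set" where
  "ideal_gen S = module.span (*) S"


subsection \<open>Projective space and homogeneous ideals\<close>

definition proj_rel :: "(('v \<Rightarrow> 'k::field) \<times> ('v \<Rightarrow> 'k)) set" where
  "proj_rel = {(v, w). v \<noteq> (\<lambda>_. 0) \<and> (\<exists>c. c \<noteq> 0 \<and> w = (\<lambda>i. c * v i))}"

definition proj_space :: "('v \<Rightarrow> 'k::field) set set" where
  "proj_space = {v. v \<noteq> (\<lambda>_. 0)} // proj_rel"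

text \<open>A polynomial vanishes at a point if it vanishes at all homogeneous coordinate vectors of the
  point; for homogeneous polynomials one coordinate vector suffices.\<close>

definition vanishes_at :: "('v::finite, 'k::field) mpoly \<Rightarrow> ('v \<Rightarrow> 'k) set \<Rightarrow> bool" where
  "vanishes_at f P \<longleftrightarrow> (\<forall>v\<in>P. eval_at v f = 0)"

definition proj_zeros :: "('v::finite, 'k::field) mpoly \<Rightarrow> ('v \<Rightarrow> 'k) set set" where
  "proj_zeros f = {P \<in> proj_space. vanishes_at f P}"

definition hyperplane :: "('v::finite \<Rightarrow> 'k::field) set set \<Rightarrow> bool" where
  "hyperplane H \<longleftrightarrow> (\<exists>f. f \<noteq> 0 \<and> homogeneous 1 f \<and> H = proj_zeros f)"

definition vanishing_ideal :: "('v::finite \<Rightarrow> 'k::field) set set \<Rightarrow> ('v, 'k) mpoly set" where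
  "vanishing_ideal X = ideal_gen {f. (\<exists>d. homogeneous d f) \<and> (\<forall>P\<in>X. vanishes_at f P)}"


subsection \<open>The action makes the polynomials a module\<close>

lemma lookup_partial:
  "Poly_Mapping.lookup (partial i g) m = of_nat (Poly_Mapping.lookup m i + 1) * Poly_Mapping.lookup g (m + Poly_Mapping.single i 1)"
proof -
  let ?e = "Poly_Mapping.single i (1::nat)"
  let ?h = "\<lambda>a. of_nat (Poly_Mapping.lookup a i) * Poly_Mapping.lookup g a"
  have eq: "Poly_Mapping.lookup (Poly_Mapping.single (a - ?e) (?h a)) m = (if a = m + ?e then ?h a else 0)"
    for a
  proof (cases "Poly_Mapping.lookup a i = 0")
    case True
    then have "a \<noteq> m + ?e" by (auto simp: lookup_add)
    with True show ?thesis by simp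
  next
    case False
    then have "a - ?e = m \<longleftrightarrow> a = m + ?e"
      by (auto simp: poly_mapping_eq_iff fun_eq_iff lookup_add lookup_minus lookup_single when_def)
    then show ?thesis by (auto simp: lookup_single when_def)
  qed
  have "Poly_Mapping.lookup (partial i g) m = (\<Sum>a\<in>Poly_Mapping.keys g. if a = m + ?e then ?h a else 0)"
    unfolding partial_def lookup_sum eq ..
  also have "\<dots> = ?h (m + ?e)"
    by (simp add: sum.delta in_keys_iff)
  finally show ?thesis by (simp add: lookup_add)
qed

lemma lookup_Const_mult: "Poly_Mapping.lookup (Const c * g) m = c * Poly_Mapping.lookup g m"
  unfolding Const_def mult_map_scale_conv_mult [symmetric]
  by (simp add: Poly_Mapping.map.rep_eq when_def)

lemma partial_add: "partial i (g + h) = partial i g + partial i h"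
  by (rule poly_mapping_eqI) (simp add: lookup_partial lookup_add algebra_simps)

lemma partial_Const_mult: "partial i (Const c * g) = Const c * partial i g"
  by (rule poly_mapping_eqI) (simp only: lookup_partial lookup_Const_mult mult.left_commute)

lemma partial_commute: "partial i (partial j g) = partial j (partial i g)"
proof (cases "i = j")
  case False
  then show ?thesis
    by (intro poly_mapping_eqI)
      (simp add: lookup_partial lookup_add lookup_single ac_simps)
qed simp

lemma comp_fun_commute_partial: "comp_fun_commute partial"
  by standard (simp add: fun_eq_iff partial_commute)

lemma comp_fun_commute_partial_pow: "comp_fun_commute (\<lambda>i. partial i ^^ e i)"
  by (rule comp_fun_commute.comp_fun_commute_funpow [OF comp_fun_commute_partial])

lemma partials_Const_mult:
  fixes g :: "('v::finite, 'k::comm_ring_1) mpoly"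
  shows "partials m (Const c * g) = Const c * partials m g"
proof -
  interpret comp_fun_commute "\<lambda>i. (partial i :: ('v, 'k) mpoly \<Rightarrow> _) ^^ Poly_Mapping.lookup m i"
    by (rule comp_fun_commute_partial_pow)
  have pow: "(partial i ^^ k) (Const c * h) = Const c * (partial i ^^ k) h"
    for i k and h :: "('v, 'k) mpoly"
    by (induction k) (auto simp: partial_Const_mult)
  let ?F = "Finite_Set.fold (\<lambda>i. (partial i :: ('v, 'k) mpoly \<Rightarrow> _) ^^ Poly_Mapping.lookup m i)"
  have "?F (Const c * g) A = Const c * ?F g A" if "finite A" for A
    using that by induction (auto simp: pow)
  then show ?thesis by (simp add: partials_def)
qed

lemma partials_add:
  fixes g h :: "('a::finite, 'b::comm_ring_1) mpoly"
  shows "partials m (g + h) = partials m g + partials m h"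
proof -
  interpret comp_fun_commute "\<lambda>i. (partial i :: ('a, 'b) mpoly \<Rightarrow> _) ^^ Poly_Mapping.lookup m i"
    by (rule comp_fun_commute_partial_pow)
  have pow: "(partial i ^^ k) (g + h) = (partial i ^^ k) g + (partial i ^^ k) h"
    for i k and g h :: "('a, 'b) mpoly"
    by (induction k) (auto simp: partial_add)
  let ?F = "Finite_Set.fold (\<lambda>i. (partial i :: ('a, 'b) mpoly \<Rightarrow> _) ^^ Poly_Mapping.lookup m i)"
  have "?F (g + h) A = ?F g A + ?F h A" if "finite A" for A
    using that by induction (auto simp: pow)
  then show ?thesis by (simp add: partials_def)
qed

lemma partials_partials:
  fixes g :: "('a::finite, 'b::comm_ring_1) mpoly"
  shows "partials a (partials b g) = partials (a + b) g"
proof -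
  let ?P = "\<lambda>e i. (partial i :: ('a, 'b) mpoly \<Rightarrow> _) ^^ Poly_Mapping.lookup e i"
  have sw: "(partial i ^^ k) (partial j h) = partial j ((partial i ^^ k) h)"
    for i j k and h :: "('a, 'b) mpoly"
    by (induction k) (auto simp: partial_commute)
  have sw2: "(partial i ^^ k) ((partial j ^^ l) h) = (partial j ^^ l) ((partial i ^^ k) h)"
    for i j k l and h :: "('a, 'b) mpoly"
    by (induction l) (auto simp: sw)
  have sw3: "Finite_Set.fold (?P a) ((partial j ^^ l) h) A = (partial j ^^ l) (Finite_Set.fold (?P a) h A)"
    if "finite A" for A j l h
    using that
  proof induction
    case (insert x A)
    interpret comp_fun_commute "?P a" by (rule comp_fun_commute_partial_pow)
    show ?case using insert by (simp add: sw2)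
  qed simp
  have "Finite_Set.fold (?P a) (Finite_Set.fold (?P b) g A) A = Finite_Set.fold (?P (a + b)) g A"
    if "finite A" for A
    using that
  proof induction
    case (insert x A)
    interpret A: comp_fun_commute "?P a" by (rule comp_fun_commute_partial_pow)
    interpret B: comp_fun_commute "?P b" by (rule comp_fun_commute_partial_pow)
    interpret C: comp_fun_commute "?P (a + b)" by (rule comp_fun_commute_partial_pow)
    have "Finite_Set.fold (?P a) (Finite_Set.fold (?P b) g (insert x A)) (insert x A)
        = ?P a x (?P b x (Finite_Set.fold (?P (a + b)) g A))"
      using insert by (simp add: sw3)
    also have "\<dots> = ?P (a + b) x (Finite_Set.fold (?P (a + b)) g A)"
      by (simp add: lookup_add funpow_add)
    also have "\<dots> = Finite_Set.fold (?P (a + b)) g (insert x A)"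
      using insert by (simp)
    finally show ?case .
  qed simp
  then show ?thesis by (simp add: partials_def)
qed

lemma partials_0 [simp]:
  fixes g :: "('a::finite, 'b::comm_ring_1) mpoly"
  shows "partials 0 g = g"
proof -
  interpret comp_fun_commute "\<lambda>i::'a. \<lambda>a::('a, 'b) mpoly. a"
    by standard auto
  have "Finite_Set.fold (\<lambda>i::'a. \<lambda>a. a) g A = g" if "finite A" for A
    using that by induction simp_all
  then show ?thesis by (simp add: partials_def id_def)
qed

lemma Const_0 [simp]: "Const 0 = 0" and Const_1 [simp]: "Const 1 = 1"
  by (simp_all add: Const_def)

lemma Const_add: "Const (a + b) = Const a + Const b"
  by (simp add: Const_def single_add)

lemma Const_mult: "Const (a * b) = Const a * Const b"
  by (simp add: Const_def mult_single)

lemma diff_act_eq_sum: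
  assumes "finite A" "Poly_Mapping.keys f \<subseteq> A"
  shows "f \<odot> g = (\<Sum>m\<in>A. Const (Poly_Mapping.lookup f m) * partials m g)"
  unfolding diff_act_def using assms
  by (intro sum.mono_neutral_left) (auto simp: in_keys_iff)

lemma diff_act_add_left: "(f + f') \<odot> g = f \<odot> g + f' \<odot> g"
proof -
  let ?A = "Poly_Mapping.keys f \<union> Poly_Mapping.keys f'"
  have "Poly_Mapping.keys (f + f') \<subseteq> ?A" by (rule Poly_Mapping.keys_add)
  then show ?thesis
    by (simp add: diff_act_eq_sum [of ?A] lookup_add Const_add distrib_right sum.distrib)
qed

lemma diff_act_add_right: "f \<odot> (g + h) = f \<odot> g + f \<odot> h"
  by (simp add: diff_act_def partials_add distrib_left sum.distrib)

lemma diff_act_single: "Poly_Mapping.single m c \<odot> g = Const c * partials m g"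
  by (simp add: diff_act_eq_sum [of "{m}"])

lemma diff_act_Var:
  fixes g :: "('a::finite, 'b::comm_ring_1) mpoly"
  shows "Var i \<odot> g = partial i g"
proof -
  define p where "p = (\<lambda>j. (partial j :: ('a, 'b) mpoly \<Rightarrow> _)
    ^^ Poly_Mapping.lookup (Poly_Mapping.single i (1::nat)) j)"
  interpret comp_fun_commute p
    unfolding p_def by (rule comp_fun_commute_partial_pow)
  have p: "p j h = (if j = i then partial i h else h)" for j h
    by (simp add: p_def lookup_single when_def)
  have "Finite_Set.fold p g A = (if i \<in> A then partial i g else g)" if "finite A" for A
    using that
  proof induction
    case (insert x A)
    then have "Finite_Set.fold p g (insert x A) = p x (Finite_Set.fold p g A)"
      by simp
    also have "\<dots> = (if i \<in> insert x A then partial i g else g)"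
      using insert p [of x "Finite_Set.fold p g A"] by auto
    finally show ?case .
  qed simp
  then show ?thesis by (simp add: Var_def diff_act_single partials_def p_def)
qed

lemma poly_mapping_single_induct:
  fixes p :: "'a \<Rightarrow>\<^sub>0 'b::comm_monoid_add"
  assumes "P 0" "\<And>p q. P p \<Longrightarrow> P q \<Longrightarrow> P (p + q)" "\<And>m c. P (Poly_Mapping.single m c)"
  shows "P p"
proof -
  have "P (\<Sum>m\<in>A. Poly_Mapping.single m (Poly_Mapping.lookup p m))" if "finite A" for A
    using that by induction (auto intro: assms)
  moreover have "p = (\<Sum>m\<in>Poly_Mapping.keys p. Poly_Mapping.single m (Poly_Mapping.lookup p m))"
    by (rule poly_mapping_eqI) (simp add: lookup_sum lookup_single when_def sum.delta in_keys_iff)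
  ultimately show ?thesis by (metis finite_keys)
qed

lemma diff_act_0_left [simp]: "0 \<odot> g = 0"
  by (simp add: diff_act_def)

lemma diff_act_0_right [simp]: "f \<odot> 0 = 0"
  using diff_act_add_right [of f 0 0] by simp

lemma diff_act_mult: "f \<odot> (g \<odot> h) = (f * g) \<odot> h"
proof (induction f rule: poly_mapping_single_induct)
  case (3 a c)
  show ?case
  proof (induction g rule: poly_mapping_single_induct)
    case (3 b d)
    show ?case
      by (simp add: diff_act_single mult_single partials_Const_mult partials_partials Const_mult mult_ac)
  qed (simp_all add: diff_act_add_left diff_act_add_right distrib_left)
qed (simp_all add: diff_act_add_left distrib_right)

lemma module_diff_act: "module (diff_act :: ('v::finite, 'k::comm_ring_1) mpoly \<Rightarrow> _)"
proof
  show "1 \<odot> x = x" for x :: "('v, 'k) mpoly"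
    using diff_act_single [of 0 1 x] by simp
qed (simp_all add: diff_act_add_left diff_act_add_right diff_act_mult)

lemma module_mult_mpoly: "module ((*) :: ('v, 'k::comm_ring_1) mpoly \<Rightarrow> _)"
  by standard (simp_all add: algebra_simps)

end

theory Submission
  imports Defs
begin

text \<open>Since \<open>g \<odot> F\<^sub>s = (g * x\<^sub>n) \<odot> F\<^sub>s\<^sub>+\<^sub>1\<close>, multiplication of the acting polynomial by \<open>x\<^sub>n\<close> carries each
  term of the chain into the next one; the last inclusion holds because \<open>R\<close> is commutative.\<close>

lemma submodule_gen_singleton: "submodule_gen {G} = range (\<lambda>g. g \<odot> G)"
  unfolding submodule_gen_def by (rule module.span_singleton [OF module_diff_act])

lemma ideal_gen_singleton:
  fixes f :: "('v, 'k::comm_ring_1) mpoly"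
  shows "ideal_gen {f} = range (\<lambda>g. g * f)"
  unfolding ideal_gen_def by (rule module.span_singleton [OF module_mult_mpoly])

lemma diff_act_left_commute: "f \<odot> g \<odot> h = g \<odot> f \<odot> h"
  by (simp add: diff_act_mult mult.commute)

text \<open>The start of the chain. Every \<open>g\<close> is allowed here: since \<open>x\<close>
  already kills \<open>G\<close>, all multiples \<open>g * x\<close> lie in \<open>Ann G\<close>,
  and \<open>g * x\<close> acts on \<open>G'\<close> as \<open>g\<close> acts on
  \<open>G\<close>.\<close>

lemma submodule_gen_subset_act_set_Ann:
  assumes "x \<odot> G' = G" and "x \<odot> G = 0"
  shows "submodule_gen {G} \<subseteq> act_set (Ann G) G'"
proof
  fix H assume "H \<in> submodule_gen {G}"
  then obtain g where "H = g \<odot> G"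
    by (auto simp: submodule_gen_singleton)
  with assms have "H = (g * x) \<odot> G'" and "g * x \<in> Ann G"
    by (simp_all add: Ann_def diff_act_mult [symmetric])
  then show "H \<in> act_set (Ann G) G'"
    by (auto simp: act_set_def)
qed

text \<open>Passing from \<open>g\<close> to \<open>g * x\<close> preserves the annihilator
  condition one level up: \<open>g * x\<close> sends \<open>G'\<close> to
  \<open>g \<odot> G\<close>, which is zero.\<close>

lemma act_set_Ann_subset_act_set_Ann:
  assumes "x \<odot> G' = G" and "x \<odot> G'' = G'"
  shows "act_set (Ann G) G' \<subseteq> act_set (Ann G') G''"
proof
  fix H assume "H \<in> act_set (Ann G) G'"
  then obtain g where "H = g \<odot> G'" and "g \<odot> G = 0"
    by (auto simp: act_set_def Ann_def)
  with assms have "H = (g * x) \<odot> G''" and "g * x \<in> Ann G'"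
    by (simp_all add: Ann_def diff_act_mult [symmetric])
  then show "H \<in> act_set (Ann G') G''"
    by (auto simp: act_set_def)
qed

text \<open>Both summands of the ideal can be moved past \<open>g\<close>: an element of
  \<open>I\<close> then meets \<open>G'\<close> and kills it, while \<open>x\<close> turns
  \<open>G'\<close> into \<open>G\<close>, which \<open>g\<close> kills.\<close>

lemma act_set_Ann_subset_perp:
  assumes "x \<odot> G' = G" and "G' \<in> perp I"
  shows "act_set (Ann G) G' \<subseteq> perp (I + ideal_gen {x})"
proof
  fix H assume "H \<in> act_set (Ann G) G'"
  then obtain g where H: "H = g \<odot> G'" and g: "g \<odot> G = 0"
    by (auto simp: act_set_def Ann_def)
  \<comment> \<open>The ideal generated by \<open>x\<close> consists of the multiples
    \<open>b * x\<close>, so these sums exhaust \<open>I + ideal_gen {x}\<close>.\<close>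
  have "(a + b * x) \<odot> H = 0" if "a \<in> I" for a b
  proof -
    have "a \<odot> H = g \<odot> a \<odot> G'"
      unfolding H by (rule diff_act_left_commute)
    moreover have "x \<odot> H = g \<odot> x \<odot> G'"
      unfolding H by (rule diff_act_left_commute)
    ultimately show ?thesis
      using assms g that by (simp add: diff_act_add_left diff_act_mult [symmetric] perp_def)
  qed
  then show "H \<in> perp (I + ideal_gen {x})"
    by (auto simp: perp_def ideal_gen_singleton elim!: set_plus_elim)
qed

theorem lemma3p10:
  fixes P :: "nat \<Rightarrow> ('n::finite option \<Rightarrow> 'k::{alg_closed_field,field_char_0}) set"
    and r :: nat
    and X :: "('n option \<Rightarrow> 'k) set set"
    and F :: "nat \<Rightarrow> ('n option, 'k) mpoly"
  assumes X_eq: "X = P ` {1..r}"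
    and distinct: "inj_on P {1..r}"
    and points: "X \<subseteq> proj_space - proj_zeros (Var None)"
    and nondegenerate: "\<not> (\<exists>H. hyperplane H \<and> X \<subseteq> H)"
    and F_perp: "\<And>t. t \<ge> 1 \<Longrightarrow> F t \<in> perp (vanishing_ideal X)"
    and F_step: "\<And>t. t > 1 \<Longrightarrow> Var None \<odot> F t = F (t - 1)"
    and F_one: "Var None \<odot> F 1 = 0"
  shows "\<forall>t\<ge>1. submodule_gen {F 1} \<subseteq> act_set (Ann (F 1)) (F 2)
    \<and> (\<forall>s\<in>{1..t}. act_set (Ann (F s)) (F (s + 1)) \<subseteq> act_set (Ann (F (s + 1))) (F (s + 2)))
    \<and> act_set (Ann (F (t + 1))) (F (t + 2)) \<subseteq> perp (vanishing_ideal X + ideal_gen {Var None})"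
proof -
  \<comment> \<open>The recursion without natural-number subtraction; \<open>s = 0\<close> stays
    excluded, as nothing is assumed about \<open>F 0\<close>.\<close>
  have step: "Var None \<odot> F (Suc s) = F s" if "s \<ge> 1" for s
    using F_step [of "Suc s"] that by simp
  show ?thesis
  proof (intro allI impI conjI ballI)
    show "submodule_gen {F 1} \<subseteq> act_set (Ann (F 1)) (F 2)"
      using step [of 1] F_one
      by (intro submodule_gen_subset_act_set_Ann [of "Var None"]) (simp_all add: numeral_2_eq_2)
  next
    fix s t :: nat
    assume "s \<in> {1..t}"
    then show "act_set (Ann (F s)) (F (s + 1)) \<subseteq> act_set (Ann (F (s + 1))) (F (s + 2))"
      \<comment> \<open>Three consecutive members \<open>F s\<close>, \<open>F (s + 1)\<close>,
        \<open>F (s + 2)\<close> are involved, hence two instances of the recursion.\<close>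
      using step [of s] step [of "Suc s"]
      by (intro act_set_Ann_subset_act_set_Ann [of "Var None"]) simp_all
  next
    fix t :: nat
    show "act_set (Ann (F (t + 1))) (F (t + 2)) \<subseteq> perp (vanishing_ideal X + ideal_gen {Var None})"
      \<comment> \<open>Here \<open>G'\<close> is \<open>F (t + 2)\<close>, the element acted upon,
        so orthogonality to the ideal of \<open>X\<close> is taken at that index.\<close>
      using step [of "Suc t"] F_perp [of "t + 2"]
      by (intro act_set_Ann_subset_perp) simp_all
  qed
qed

end
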